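(* For every $i\in\mathbb{N}$, there exist $i$ distinct closed subsemigroups of $\mathbb{N}^\mathbb{N}$, each contained in $\mathfrak{F}$, that are pairwise incomparable under $\preccurlyeq$.
   Context: $\mathbb{N}=\{0,1,2,\ldots\}$ and $\mathbb{N}^\mathbb{N}$ is the semigroup of all maps $\mathbb{N}\to\mathbb{N}$ under composition, with the product topology arising from the discrete topology on $\mathbb{N}$ ("closed" refers to this topology). $\mathfrak{F}$ is the set of all $f\in\mathbb{N}^\mathbb{N}$ with finite image. For $U,V\subseteq\mathbb{N}^\mathbb{N}$, $U\preccurlyeq V$ means there is a countable $C\subseteq\mathbb{N}^\mathbb{N}$ such that $U$ is contained in the subsemigroup generated by $V\cup C$; $U,V$ are incomparable if neither $U\preccurlyeq V$ nor $V\preccurlyeq U$. *)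

theory Defs
  imports "HOL-Analysis.Analysis"
begin

text \<open>
  The type \<open>nat \<Rightarrow> nat\<close> carries the product topology of the discrete space \<open>nat\<close>
  through the library's type class instances for \<open>fun\<close> and \<open>nat\<close>, so the class predicate
  \<open>closed\<close> is closedness in that topology.
\<close>

definition subsemigroup_of_maps :: "(nat \<Rightarrow> nat) set \<Rightarrow> bool" where
  "subsemigroup_of_maps S \<longleftrightarrow> S \<noteq> {} \<and> (\<forall>f\<in>S. \<forall>g\<in>S. f \<circ> g \<in> S)"

text \<open>Only nonempty products are formed: the identity map is not added.\<close>

inductive_set semigroup_generated :: "(nat \<Rightarrow> nat) set \<Rightarrow> (nat \<Rightarrow> nat) set"
  for U :: "(nat \<Rightarrow> nat) set" where
  base: "f \<in> U \<Longrightarrow> f \<in> semigroup_generated U"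
| comp: "f \<in> semigroup_generated U \<Longrightarrow> g \<in> semigroup_generated U \<Longrightarrow>
    f \<circ> g \<in> semigroup_generated U"

definition finite_image_maps :: "(nat \<Rightarrow> nat) set" where
  "finite_image_maps = {f. finite (range f)}"

definition generated_preorder :: "(nat \<Rightarrow> nat) set \<Rightarrow> (nat \<Rightarrow> nat) set \<Rightarrow> bool"
    (infix \<open>\<preceq>\<close> 50) where
  "U \<preceq> V \<longleftrightarrow> (\<exists>C. countable C \<and> U \<subseteq> semigroup_generated (V \<union> C))"

definition incomparable :: "(nat \<Rightarrow> nat) set \<Rightarrow> (nat \<Rightarrow> nat) set \<Rightarrow> bool" where
  "incomparable U V \<longleftrightarrow> \<not> U \<preceq> V \<and> \<not> V \<preceq> U"

end

theory Submission
  imports Defs "HOL-Library.Nat_Bijection" "HOL-Library.Sublist"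
begin

text \<open>
  Since a map with finite image only sees finitely many values of whatever is composed to its
  left, \<open>U \<preceq> V\<close> for \<open>V \<subseteq> \<FF>\<close> forces \<open>U\<close> to be covered, up to a countable set, by countably many
  sets \<open>d \<circ> V \<circ> c\<close>. Such sets cannot increase the number of values of a map, nor the largest size
  of a set of points on which two-valued maps realise all patterns.

  For \<open>2 \<le> r\<close> and \<open>1 \<le> s\<close> there is a closed semigroup whose nonzero members all have exactly \<open>r\<close>
  values and which shatters sets of \<open>s\<close> points but none of \<open>s + 1\<close> points. Its members follow
  branches of the tree of finite sequences of natural numbers: every node carries \<open>s\<close> points, at
  which the values are the binary digits of the letter that the branch chooses there. Points at
  distinct nodes are never shattered, because the deeper node determines the letter at the
  shallower one. By a Baire category argument on branches, one of the countably many covering sets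
  would shatter the \<open>s\<close> points of some node. Hence the semigroups with parameters \<open>(r, s)\<close> and
  \<open>(r', s')\<close> are incomparable whenever \<open>r < r'\<close> and \<open>s' < s\<close>.
\<close>

section \<open>Normal forms for generated maps\<close>

lemma countable_finite_support_maps:
  "countable {f :: nat \<Rightarrow> nat. finite {x. f x \<noteq> 0}}"
proof -
  have "{f :: nat \<Rightarrow> nat. finite {x. f x \<noteq> 0}}
      \<subseteq> range (\<lambda>xs n. if n < length xs then xs ! n else 0)" (is "_ \<subseteq> range ?F")
  proof
    fix f :: "nat \<Rightarrow> nat"
    assume "f \<in> {f. finite {x. f x \<noteq> 0}}"
    then obtain N where N: "\<And>x. f x \<noteq> 0 \<Longrightarrow> x < N"
      using finite_nat_set_iff_bounded[of "{x. f x \<noteq> 0}"] by auto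
    have "f = ?F (map f [0..<N])"
      using N by (auto simp: fun_eq_iff)
    then show "f \<in> range ?F" by blast
  qed
  then show ?thesis
    by (rule countable_subset) simp
qed

lemma countable_semigroup_generated:
  assumes "countable C"
  shows "countable (semigroup_generated C)"
proof -
  have "semigroup_generated C \<subseteq> (\<lambda>fs. foldr (\<circ>) fs id) ` lists C"
  proof
    fix f
    assume "f \<in> semigroup_generated C"
    then show "f \<in> (\<lambda>fs. foldr (\<circ>) fs id) ` lists C"
    proof induction
      case (base f)
      then have "[f] \<in> lists C" "f = foldr (\<circ>) [f] id" by auto
      then show ?case by blast
    next
      case (comp f g)
      then obtain fs gs where fs: "fs \<in> lists C" "f = foldr (\<circ>) fs id"
        and gs: "gs \<in> lists C" "g = foldr (\<circ>) gs id" by blast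
      have "foldr (\<circ>) (hs @ gs) id = foldr (\<circ>) hs id \<circ> foldr (\<circ>) gs id"
        for hs :: "(nat \<Rightarrow> nat) list"
        by (induction hs) (auto simp: fun_eq_iff)
      then have "f \<circ> g = foldr (\<circ>) (fs @ gs) id" "fs @ gs \<in> lists C"
        using fs gs by auto
      then show ?case by blast
    qed
  qed
  then show ?thesis
    by (rule countable_subset) (simp add: assms)
qed

text \<open>Whatever stands left of a member of \<open>V\<close> matters only on its finite range,
  so it can be cut down to finite support. For countable \<open>C\<close> this leaves only countably
  many pairs \<open>(d, c)\<close>.\<close>

lemma semigroup_generated_finite_image_cases:
  assumes V: "V \<subseteq> finite_image_maps" and f: "f \<in> semigroup_generated (V \<union> C)"
  shows "f \<in> semigroup_generated C \<or>
    (\<exists>d g c. finite {x. d x \<noteq> 0} \<and> g \<in> V \<and> c \<in> insert id (semigroup_generated C) \<and>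
      f = d \<circ> g \<circ> c)"
proof -
  have absorb: "\<exists>d. finite {x. d x \<noteq> 0} \<and> h \<circ> g = d \<circ> g"
    if "g \<in> V" for h g :: "nat \<Rightarrow> nat"
  proof (intro exI conjI)
    have "finite (range g)" using that V by (auto simp: finite_image_maps_def)
    then show "finite {x. (if x \<in> range g then h x else 0) \<noteq> 0}"
      by (rule rev_finite_subset) auto
    show "h \<circ> g = (\<lambda>x. if x \<in> range g then h x else 0) \<circ> g" by auto
  qed
  show ?thesis
    using f
  proof induction
    case (base f)
    show ?case
    proof (cases "f \<in> C")
      case True
      then show ?thesis by (auto intro: semigroup_generated.base)
    next
      case False
      then have "f \<in> V" using base by auto
      moreover obtain d where "finite {x. d x \<noteq> 0}" "id \<circ> f = d \<circ> f"
        using absorb[OF \<open>f \<in> V\<close>] by blast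
      moreover have "f = d \<circ> f \<circ> id" using calculation by simp
      ultimately show ?thesis by blast
    qed
  next
    case (comp f g)
    \<comment> \<open>The right factor is split first: if it contains a member of \<open>V\<close>,
      everything further left is absorbed into one \<open>d'\<close>; otherwise it is a product over
      \<open>C\<close> and joins the right end of \<open>f\<close>.\<close>
    from comp.IH(2) show ?case
    proof (elim disjE exE conjE)
      fix d v c
      assume v: "v \<in> V" and c: "c \<in> insert id (semigroup_generated C)" and g: "g = d \<circ> v \<circ> c"
      obtain d' where "finite {x. d' x \<noteq> 0}" "(f \<circ> d) \<circ> v = d' \<circ> v"
        using absorb[OF v] by blast
      moreover have "f \<circ> g = d' \<circ> v \<circ> c"
        using calculation(2) g by (auto simp: fun_eq_iff)
      ultimately show ?thesis using v c by blast
    next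
      assume g: "g \<in> semigroup_generated C"
      from comp.IH(1) show ?thesis
      proof (elim disjE exE conjE)
        assume "f \<in> semigroup_generated C"
        then show ?thesis using g semigroup_generated.comp by blast
      next
        fix d v c
        assume "finite {x. d x \<noteq> 0}" "v \<in> V" "f = d \<circ> v \<circ> c"
          and c: "c \<in> insert id (semigroup_generated C)"
        moreover have "c \<circ> g \<in> insert id (semigroup_generated C)"
          using c g by (auto intro: semigroup_generated.comp)
        moreover have "f \<circ> g = d \<circ> v \<circ> (c \<circ> g)"
          using \<open>f = d \<circ> v \<circ> c\<close> by (simp add: comp_assoc)
        ultimately show ?thesis by blast
      qed
    qed
  qed
qed

lemma generated_preorder_refl: "U \<preceq> U"
  unfolding generated_preorder_def by (auto intro!: exI[of _ "{}"] semigroup_generated.base)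

section \<open>Baire category for sequences\<close>

definition initial_segment :: "(nat \<Rightarrow> nat) \<Rightarrow> nat \<Rightarrow> nat list" where
  "initial_segment x n = map x [0..<n]"

lemma length_initial_segment [simp]: "length (initial_segment x n) = n"
  by (simp add: initial_segment_def)

lemma take_initial_segment: "m \<le> n \<Longrightarrow> take m (initial_segment x n) = initial_segment x m"
  by (simp add: initial_segment_def take_map)

lemma initial_segment_nth [simp]: "m < n \<Longrightarrow> initial_segment x n ! m = x m"
  by (simp add: initial_segment_def)

text \<open>The closure contains the cylinder of all sequences that extend
  \<open>\<sigma>\<close>.\<close>

definition somewhere_dense :: "(nat \<Rightarrow> nat) set \<Rightarrow> bool" where
  "somewhere_dense A \<longleftrightarrow>
    (\<exists>\<sigma>. \<forall>\<tau>. prefix \<sigma> \<tau> \<longrightarrow> (\<exists>x\<in>A. initial_segment x (length \<tau>) = \<tau>))"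

text \<open>This is the Baire category theorem for the space of all sequences.\<close>

lemma somewhere_dense_of_countable_cover:
  assumes "countable I" and cover: "\<And>x. \<exists>k\<in>I. x \<in> A k"
  shows "\<exists>k\<in>I. somewhere_dense (A k)"
proof (rule ccontr)
  assume contra: "\<not> (\<exists>k\<in>I. somewhere_dense (A k))"
  define E where "E = from_nat_into I"
  have "I \<noteq> {}" using cover by blast
  then have rangeE: "range E = I"
    using \<open>countable I\<close> by (simp add: E_def)
  have avoid: "\<exists>\<tau>. strict_prefix \<sigma> \<tau> \<and> (\<forall>x\<in>A (E n). initial_segment x (length \<tau>) \<noteq> \<tau>)"
    for \<sigma> n
  proof -
    have "E n \<in> I" using rangeE by auto
    then have "\<not> somewhere_dense (A (E n))" using contra by blast
    \<comment> \<open>The extra letter 0 makes the extension strict, so that the chain grows to an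
      infinite sequence.\<close>
    then obtain \<tau> where "prefix (\<sigma> @ [0]) \<tau>"
      "\<forall>x\<in>A (E n). initial_segment x (length \<tau>) \<noteq> \<tau>"
      unfolding somewhere_dense_def by blast
    moreover have "strict_prefix \<sigma> \<tau>"
      using calculation(1) by (auto simp: strict_prefix_def prefix_def)
    ultimately show ?thesis by blast
  qed
  have "\<exists>S. \<forall>n. strict_prefix (S n) (S (Suc n)) \<and>
      (\<forall>x\<in>A (E n). initial_segment x (length (S (Suc n))) \<noteq> S (Suc n))"
    using dependent_nat_choice[of "\<lambda>_ _. True" "\<lambda>n \<sigma> \<tau>. strict_prefix \<sigma> \<tau> \<and>
      (\<forall>x\<in>A (E n). initial_segment x (length \<tau>) \<noteq> \<tau>)"] avoid
    by simp
  then obtain S where step: "\<And>n. strict_prefix (S n) (S (Suc n))"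
    and miss: "\<And>n x. x \<in> A (E n) \<Longrightarrow> initial_segment x (length (S (Suc n))) \<noteq> S (Suc n)"
    by blast
  have mono: "prefix (S m) (S n)" if "m \<le> n" for m n
    using that step
    by (induction rule: dec_induct)
      (auto intro: prefix_order.trans prefix_order.less_imp_le)
  have len: "n \<le> length (S n)" for n
  proof (induction n)
    case (Suc n)
    then show ?case using prefix_length_less[OF step[of n]] by simp
  qed simp
  have agree: "S m ! k = S n ! k" if "k < length (S m)" "k < length (S n)" for k m n
    using that mono[of m n] mono[of n m] by (cases "m \<le> n") (auto simp: prefix_def nth_append)
  \<comment> \<open>The limit of the chain: \<open>S (Suc k)\<close> has length at least
    \<open>k + 1\<close>, so its entry \<open>k\<close> exists.\<close>
  define x where "x k = S (Suc k) ! k" for k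
  have x: "initial_segment x (length (S n)) = S n" for n
    by (rule nth_equalityI) (auto simp: x_def intro!: agree Suc_le_lessD len)
  obtain k where "k \<in> I" "x \<in> A k" using cover by blast
  then obtain n where "x \<in> A (E n)" using rangeE by auto
  then show False using miss x by blast
qed

section \<open>The closed semigroups of tree maps\<close>

text \<open>
  The first \<open>2 * r\<close> arguments of a member of the semigroup are reserved: \<open>0, \<dots>, r - 1\<close> are sent to
  \<open>0\<close>, so that all products vanish, and \<open>r, \<dots>, 2 * r - 1\<close> are sent to the \<open>r\<close> possible values. The
  remaining arguments are the points of the tree.
\<close>

definition tree_point :: "nat \<Rightarrow> nat list \<Rightarrow> nat \<Rightarrow> nat" where
  "tree_point r \<sigma> i = 2 * r + prod_encode (list_encode \<sigma>, i)"

lemma reserved_or_tree_point: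
  obtains "p < r" | q where "q < r" "p = r + q" | \<sigma> i where "p = tree_point r \<sigma> i"
proof -
  consider "p < r" | "r \<le> p" "p < 2 * r" | "2 * r \<le> p" by linarith
  then show thesis
  proof cases
    case 2
    then show ?thesis using that(2)[of "p - r"] by simp
  next
    case 3
    obtain m i where mi: "prod_decode (p - 2 * r) = (m, i)" by fastforce
    then have "prod_encode (m, i) = p - 2 * r" by (metis prod_decode_inverse)
    then have "p = tree_point r (list_decode m) i" using 3 by (simp add: tree_point_def)
    then show ?thesis by (rule that(3))
  qed (rule that(1))
qed

text \<open>The value that reaching \<open>\<tau>\<close> forces at a node \<open>\<sigma>\<close>
  not extending \<open>\<tau>\<close>: a digit of the letter chosen at \<open>\<sigma>\<close> on
  the way to \<open>\<tau>\<close>, or 0 if \<open>\<sigma>\<close> is off that way.\<close>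

definition determined_value :: "nat \<Rightarrow> nat list \<Rightarrow> nat list \<Rightarrow> nat \<Rightarrow> nat" where
  "determined_value s \<tau> \<sigma> i =
    of_bool (strict_prefix \<sigma> \<tau> \<and> i < s \<and> i \<in> set_decode (\<tau> ! length \<sigma>))"

text \<open>
  This is a superset of the set of maps belonging to branches, described by conditions on pairs of
  coordinates, which makes it closed.
\<close>

definition tree_maps :: "nat \<Rightarrow> nat \<Rightarrow> (nat \<Rightarrow> nat) set" where
  "tree_maps r s = {f.
    (\<forall>p<r. f p = 0) \<and> (\<forall>p<r. f (r + p) = p) \<and>
    (\<forall>\<sigma> i. f (tree_point r \<sigma> i) = 0 \<or> f (tree_point r \<sigma> i) = 1) \<and>
    (\<forall>\<sigma> i. s \<le> i \<longrightarrow> f (tree_point r \<sigma> i) = 0) \<and>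
    (\<forall>\<sigma> \<tau> i j. f (tree_point r \<tau> j) = 1 \<longrightarrow> \<not> prefix \<tau> \<sigma> \<longrightarrow>
      f (tree_point r \<sigma> i) = determined_value s \<tau> \<sigma> i)}"

definition tree_semigroup :: "nat \<Rightarrow> nat \<Rightarrow> (nat \<Rightarrow> nat) set" where
  "tree_semigroup r s = insert (\<lambda>_. 0) (tree_maps r s)"

lemma tree_maps_less:
  assumes "2 \<le> r" "f \<in> tree_maps r s"
  shows "f p < r"
proof (cases rule: reserved_or_tree_point[of p r])
  case (3 \<sigma> i)
  have "f p = 0 \<or> f p = 1" using assms(2) unfolding 3 tree_maps_def by blast
  then show ?thesis using assms(1) by auto
qed (use assms in \<open>auto simp: tree_maps_def\<close>)

lemma tree_semigroup_less:
  assumes "2 \<le> r" "f \<in> tree_semigroup r s"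
  shows "f p < r"
  using assms tree_maps_less[of r f s p] by (auto simp: tree_semigroup_def)

lemma subsemigroup_tree_semigroup:
  assumes "2 \<le> r"
  shows "subsemigroup_of_maps (tree_semigroup r s)"
proof -
  have "f \<circ> g = (\<lambda>_. 0)" if "f \<in> tree_semigroup r s" "g \<in> tree_semigroup r s" for f g
  proof
    fix p
    have "g p < r" using assms that(2) by (rule tree_semigroup_less)
    then show "(f \<circ> g) p = 0"
      using that(1) by (auto simp: tree_semigroup_def tree_maps_def)
  qed
  then show ?thesis
    by (auto simp: subsemigroup_of_maps_def tree_semigroup_def)
qed

lemma tree_semigroup_finite_image:
  assumes "2 \<le> r"
  shows "tree_semigroup r s \<subseteq> finite_image_maps"
proof
  fix f
  assume "f \<in> tree_semigroup r s"
  then have "range f \<subseteq> {..<r}" using tree_semigroup_less[OF assms] by auto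
  then show "f \<in> finite_image_maps"
    by (auto simp: finite_image_maps_def intro: finite_subset)
qed

text \<open>Evaluation is continuous into a discrete space, so \<open>f p = a\<close> is clopen:
  open as a premise of an implication, closed as a conclusion.\<close>

lemma closed_tree_semigroup: "closed (tree_semigroup r s)"
proof -
  have cont: "continuous_on UNIV (\<lambda>f :: nat \<Rightarrow> nat. f p)" for p
    by (rule continuous_on_product_coordinates)
  have cl: "closed {f :: nat \<Rightarrow> nat. f p = a}" for p a
    by (intro closed_Collect_eq cont continuous_on_const)
  have "open ((\<lambda>f :: nat \<Rightarrow> nat. f p) -` {a})" for p a
    by (intro open_vimage cont) (simp add: open_discrete)
  then have op: "open {f :: nat \<Rightarrow> nat. f p = a}" for p a
    by (simp add: vimage_def)
  have "closed (tree_maps r s)"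
    unfolding tree_maps_def
    by (intro closed_Collect_conj closed_Collect_all closed_Collect_imp closed_Collect_disj
        cl op open_Collect_const)
  moreover have "closed {f :: nat \<Rightarrow> nat. \<forall>p. f p = 0}"
    by (intro closed_Collect_all cl)
  moreover have "tree_semigroup r s = {f. \<forall>p. f p = 0} \<union> tree_maps r s"
    by (auto simp: tree_semigroup_def)
  ultimately show ?thesis by (simp add: closed_Un)
qed

definition branch_map :: "nat \<Rightarrow> nat \<Rightarrow> (nat \<Rightarrow> nat) \<Rightarrow> nat \<Rightarrow> nat" where
  "branch_map r s x p =
    (if p < r then 0
     else if p < 2 * r then p - r
     else let (m, i) = prod_decode (p - 2 * r); \<sigma> = list_decode m in
       of_bool (\<sigma> = initial_segment x (length \<sigma>) \<and> i < s \<and> i \<in> set_decode (x (length \<sigma>))))"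

lemma branch_map_tree_point:
  "branch_map r s x (tree_point r \<sigma> i) =
    of_bool (\<sigma> = initial_segment x (length \<sigma>) \<and> i < s \<and> i \<in> set_decode (x (length \<sigma>)))"
  by (simp add: branch_map_def tree_point_def)

lemma branch_map_reserved: "p < r \<Longrightarrow> branch_map r s x (r + p) = p"
  by (simp add: branch_map_def)

text \<open>A value 1 at a point of \<open>\<tau>\<close> puts \<open>\<tau>\<close> on the branch
  \<open>x\<close>. A node not extending \<open>\<tau>\<close> is then either a proper prefix of
  \<open>\<tau>\<close>, where both sides read the same letter, or off the branch, where both are
  0.\<close>

lemma branch_map_in_tree_maps: "branch_map r s x \<in> tree_maps r s"
proof -
  have "branch_map r s x (tree_point r \<sigma> i) = determined_value s \<tau> \<sigma> i"
    if one: "branch_map r s x (tree_point r \<tau> j) = 1" and np: "\<not> prefix \<tau> \<sigma>" for \<sigma> \<tau> i j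
  proof -
    have \<tau>: "\<tau> = initial_segment x (length \<tau>)"
      using one unfolding branch_map_tree_point of_bool_eq_1_iff by blast
    show ?thesis
    proof (cases "\<sigma> = initial_segment x (length \<sigma>)")
      case True
      have "length \<sigma> < length \<tau>"
      proof (rule ccontr)
        assume "\<not> length \<sigma> < length \<tau>"
        then have "take (length \<tau>) \<sigma> = \<tau>"
          using True \<tau> take_initial_segment[of "length \<tau>" "length \<sigma>" x] by simp
        then show False using np take_is_prefix[of "length \<tau>" \<sigma>] by simp
      qed
      moreover from this have "take (length \<sigma>) \<tau> = \<sigma>"
        using True \<tau> take_initial_segment[of "length \<sigma>" "length \<tau>" x] by simp
      ultimately have "strict_prefix \<sigma> \<tau>" "\<tau> ! length \<sigma> = x (length \<sigma>)"
        using take_is_prefix[of "length \<sigma>" \<tau>] \<tau> initial_segment_nth[of "length \<sigma>" "length \<tau>" x]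
        by (auto simp: strict_prefix_def)
      then show ?thesis using True by (simp add: branch_map_tree_point determined_value_def)
    next
      case False
      have "\<not> strict_prefix \<sigma> \<tau>"
      proof
        assume "strict_prefix \<sigma> \<tau>"
        then have "\<sigma> = take (length \<sigma>) \<tau>" "length \<sigma> \<le> length \<tau>"
          by (auto simp: strict_prefix_def prefix_def)
        then show False using False \<tau> take_initial_segment[of "length \<sigma>" "length \<tau>" x] by simp
      qed
      then show ?thesis using False by (simp add: branch_map_tree_point determined_value_def)
    qed
  qed
  moreover have "branch_map r s x p = 0" if "p < r" for p
    using that by (simp add: branch_map_def)
  moreover have "branch_map r s x (tree_point r \<sigma> i) = 0 \<or>
      branch_map r s x (tree_point r \<sigma> i) = 1" for \<sigma> i
    by (simp add: branch_map_tree_point)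
  moreover have "branch_map r s x (tree_point r \<sigma> i) = 0" if "s \<le> i" for \<sigma> i
    using that by (simp add: branch_map_tree_point)
  ultimately show ?thesis
    unfolding tree_maps_def using branch_map_reserved by blast
qed

section \<open>Bounds on shattered sets\<close>

lemma not_shattered_at_distinct_nodes:
  assumes np: "\<not> prefix \<tau> \<sigma>"
    and all: "\<And>a b. \<exists>g\<in>tree_maps r s.
      d (g (tree_point r \<tau> j)) = (of_bool a :: nat) \<and>
      d (g (tree_point r \<sigma> i)) = (of_bool b :: nat)"
  shows False
proof -
  have val: "g (tree_point r \<rho> k) = 0 \<or> g (tree_point r \<rho> k) = 1"
    if "g \<in> tree_maps r s" for g \<rho> k
    using that unfolding tree_maps_def by blast
  \<comment> \<open>As both values occur at \<open>\<tau>\<close>, \<open>d\<close> permutes 0 and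
    1; the image of 1 is \<open>of_bool a\<close>. Asking for \<open>a\<close> at
    \<open>\<tau>\<close> forces \<open>?e\<close> at \<open>\<sigma>\<close>, so the opposite of
    \<open>d ?e\<close> cannot occur there.\<close>
  obtain a where a: "d 1 = (of_bool a :: nat)" "d 0 = (of_bool (\<not> a) :: nat)"
    using all[of True True] all[of False True] val by (metis of_bool_eq_iff)
  let ?e = "determined_value s \<tau> \<sigma> i"
  obtain b where b: "d ?e = (of_bool b :: nat)"
    using a by (cases "?e = 0") (auto simp: determined_value_def split: if_splits)
  obtain g where g: "g \<in> tree_maps r s" "d (g (tree_point r \<tau> j)) = (of_bool a :: nat)"
    "d (g (tree_point r \<sigma> i)) = (of_bool (\<not> b) :: nat)"
    using all by blast
  have "g (tree_point r \<tau> j) = 1"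
    using val[OF g(1), of \<tau> j] a g(2) by (cases a) auto
  then have "g (tree_point r \<sigma> i) = ?e"
    using g(1) np unfolding tree_maps_def by blast
  then show False using b g(3) by (cases b) simp_all
qed

text \<open>Shattered points are not constant, hence are tree points with index below
  \<open>s\<close>. They pairwise share a node, so their indices are distinct.\<close>

lemma shattered_size_le:
  fixes d q :: "nat \<Rightarrow> nat"
  assumes all: "\<And>B. B \<subseteq> {..<n} \<Longrightarrow>
    \<exists>g\<in>tree_maps r s. \<forall>i<n. d (g (q i)) = (of_bool (i \<in> B) :: nat)"
  shows "n \<le> s"
proof -
  have "\<exists>\<tau> j. j < s \<and> q i = tree_point r \<tau> j" if i: "i < n" for i
  proof -
    obtain g where g: "g \<in> tree_maps r s" "d (g (q i)) = 1"
      using all[of "{i}"] i by auto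
    obtain h where h: "h \<in> tree_maps r s" "d (h (q i)) = 0"
      using all[of "{}"] i by auto
    have ne: "g (q i) \<noteq> h (q i)" using g h by auto
    show ?thesis
    proof (cases rule: reserved_or_tree_point[of "q i" r])
      case (3 \<tau> j)
      have "j < s"
      proof (rule ccontr)
        assume "\<not> j < s"
        then have "g (q i) = 0" "h (q i) = 0" using g h unfolding 3 tree_maps_def by auto
        then show False using ne by simp
      qed
      then show ?thesis using 3 by blast
    qed (use g h ne in \<open>auto simp: tree_maps_def\<close>)
  qed
  then obtain T J where J: "\<And>i. i < n \<Longrightarrow> J i < s"
    and q: "\<And>i. i < n \<Longrightarrow> q i = tree_point r (T i) (J i)"
    by metis
  have pair: "\<exists>g\<in>tree_maps r s. d (g (q i)) = of_bool a \<and> d (g (q k)) = of_bool b"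
    if "i < n" "k < n" "i \<noteq> k" for i k a b
  proof -
    obtain g where "g \<in> tree_maps r s"
      "\<forall>l<n. d (g (q l)) = (of_bool (l \<in> {l. l < n \<and> (l = i \<and> a \<or> l = k \<and> b)}) :: nat)"
      using all[of "{l. l < n \<and> (l = i \<and> a \<or> l = k \<and> b)}"] by auto
    then show ?thesis using that by (intro bexI[of _ g]) auto
  qed
  have T: "T i = T k" if "i < n" "k < n" for i k
  proof (rule ccontr)
    assume ne: "T i \<noteq> T k"
    then have "i \<noteq> k" by auto
    note ik = pair[OF that \<open>i \<noteq> k\<close>, unfolded q[OF that(1)] q[OF that(2)]]
    note ki = pair[OF that(2,1) \<open>i \<noteq> k\<close>[symmetric], unfolded q[OF that(1)] q[OF that(2)]]
    from ne consider "\<not> prefix (T i) (T k)" | "\<not> prefix (T k) (T i)"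
      using prefix_order.antisym by blast
    then show False
    proof cases
      case 1
      show ?thesis
        by (rule not_shattered_at_distinct_nodes[OF 1]) (rule ik)
    next
      case 2
      show ?thesis
        by (rule not_shattered_at_distinct_nodes[OF 2]) (rule ki)
    qed
  qed
  have "inj_on J {..<n}"
  proof (rule inj_onI, rule ccontr)
    fix i k
    assume ik: "i \<in> {..<n}" "k \<in> {..<n}" "J i = J k" "i \<noteq> k"
    then have "q i = q k" using q[of i] q[of k] T[of i k] by simp
    then show False using pair[of i k True False] ik by auto
  qed
  then have "card {..<n} \<le> card {..<s}"
    using J by (intro card_inj_on_le) auto
  then show ?thesis by simp
qed

section \<open>Comparison of parameters and the antichain\<close>

text \<open>Baire category yields one piece of the cover that is dense in a cylinder. The points at
  the node of that cylinder bound \<open>s\<close>, and the values at \<open>r + p\<close> bound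
  \<open>r\<close>.\<close>

lemma tree_semigroup_le_imp:
  assumes "2 \<le> r'" "2 \<le> r" "1 \<le> s" and le: "tree_semigroup r s \<preceq> tree_semigroup r' s'"
  shows "r \<le> r' \<and> s \<le> s'"
proof -
  obtain C where C: "countable C"
    "tree_semigroup r s \<subseteq> semigroup_generated (tree_semigroup r' s' \<union> C)"
    using le unfolding generated_preorder_def by blast
  define G where "G = semigroup_generated C"
  define D where "D = {d :: nat \<Rightarrow> nat. finite {x. d x \<noteq> 0}}"
  define A where "A k = (case k of Inl h \<Rightarrow> {x. branch_map r s x = h}
    | Inr (d, c) \<Rightarrow> {x. \<exists>g\<in>tree_maps r' s'. branch_map r s x = d \<circ> g \<circ> c})"
    for k :: "(nat \<Rightarrow> nat) + (nat \<Rightarrow> nat) \<times> (nat \<Rightarrow> nat)"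
  have count: "countable (G <+> D \<times> insert id G)"
    using countable_semigroup_generated[OF C(1)] countable_finite_support_maps
    by (auto simp: G_def D_def)
  have cover: "\<exists>k \<in> G <+> D \<times> insert id G. x \<in> A k" for x
  proof -
    have "branch_map r s x \<in> semigroup_generated (tree_semigroup r' s' \<union> C)"
      using C(2) branch_map_in_tree_maps[of r s x] by (auto simp: tree_semigroup_def)
    from semigroup_generated_finite_image_cases[OF tree_semigroup_finite_image[OF assms(1)] this]
    consider "branch_map r s x \<in> G"
      | d g c where "d \<in> D" "g \<in> tree_semigroup r' s'" "c \<in> insert id G"
        "branch_map r s x = d \<circ> g \<circ> c"
      unfolding G_def D_def by blast
    then show ?thesis
    proof cases
      case 1
      then show ?thesis by (intro bexI[of _ "Inl (branch_map r s x)"]) (auto simp: A_def)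
    next
      case (2 d g c)
      \<comment> \<open>A branch map takes the values 0 and 1 at \<open>r\<close> and
        \<open>r + 1\<close>, so it is not constant.\<close>
      have "g \<noteq> (\<lambda>_. 0)"
      proof
        assume "g = (\<lambda>_. 0)"
        then have "branch_map r s x (r + 0) = branch_map r s x (r + 1)" using 2(4) by simp
        then show False using assms(2) branch_map_reserved[of 0 r s x]
            branch_map_reserved[of 1 r s x] by simp
      qed
      then have "g \<in> tree_maps r' s'" using 2(2) by (simp add: tree_semigroup_def)
      then show ?thesis using 2 by (intro bexI[of _ "Inr (d, c)"]) (auto simp: A_def)
    qed
  qed
  obtain k where "somewhere_dense (A k)"
    using somewhere_dense_of_countable_cover[of _ A, OF count cover] by blast
  then obtain \<sigma> where dense:
    "\<And>\<tau>. prefix \<sigma> \<tau> \<Longrightarrow> \<exists>x\<in>A k. initial_segment x (length \<tau>) = \<tau>"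
    unfolding somewhere_dense_def by blast
  have pattern: "\<exists>x\<in>A k. \<forall>i<s. branch_map r s x (tree_point r \<sigma> i) = of_bool (i \<in> B)"
    if "B \<subseteq> {..<s}" for B
  proof -
    \<comment> \<open>The letter encoding \<open>B\<close> makes the digits read at
      \<open>\<sigma>\<close> realise the pattern \<open>B\<close>.\<close>
    let ?\<tau> = "\<sigma> @ [set_encode B]"
    obtain x where x: "x \<in> A k" "initial_segment x (length ?\<tau>) = ?\<tau>"
      using dense[of ?\<tau>] by auto
    have "initial_segment x (length \<sigma>) = \<sigma>"
      using take_initial_segment[of "length \<sigma>" "length ?\<tau>" x] unfolding x(2) by simp
    moreover have "x (length \<sigma>) = set_encode B"
      using initial_segment_nth[of "length \<sigma>" "length ?\<tau>" x] unfolding x(2) by simp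
    moreover have "finite B" using that finite_subset by blast
    ultimately show ?thesis
      using x(1) by (intro bexI[of _ x]) (auto simp: branch_map_tree_point)
  qed
  show ?thesis
  proof (cases k)
    case (Inl h)
    \<comment> \<open>A piece with a single map cannot realise two patterns;
      \<open>1 \<le> s\<close> supplies the point.\<close>
    have "h (tree_point r \<sigma> 0) = 1" "h (tree_point r \<sigma> 0) = 0"
      using pattern[of "{0}"] pattern[of "{}"] assms(3) Inl by (auto simp: A_def)
    then show ?thesis by simp
  next
    case (Inr dc)
    then obtain d c where A: "A k = {x. \<exists>g\<in>tree_maps r' s'. branch_map r s x = d \<circ> g \<circ> c}"
      by (cases dc) (simp add: A_def)
    have "s \<le> s'"
    proof (rule shattered_size_le[of s r' s' d "\<lambda>i. c (tree_point r \<sigma> i)"])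
      fix B
      assume "B \<subseteq> {..<s}"
      from pattern[OF this] obtain x g where "g \<in> tree_maps r' s'"
        "branch_map r s x = d \<circ> g \<circ> c"
        "\<forall>i<s. branch_map r s x (tree_point r \<sigma> i) = of_bool (i \<in> B)"
        unfolding A by blast
      then show "\<exists>g\<in>tree_maps r' s'. \<forall>i<s. d (g (c (tree_point r \<sigma> i))) = of_bool (i \<in> B)"
        by (intro bexI[of _ g]) simp_all
    qed
    moreover have "r \<le> r'"
    proof -
      obtain x g where g: "g \<in> tree_maps r' s'" and x: "branch_map r s x = d \<circ> g \<circ> c"
        using pattern[of "{}"] A by blast
      have "{..<r} \<subseteq> d ` {..<r'}"
      proof
        fix p
        assume "p \<in> {..<r}"
        then have "p = d (g (c (r + p)))"
          using branch_map_reserved[of p r s x] x by simp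
        then show "p \<in> d ` {..<r'}" using tree_maps_less[OF assms(1) g] by blast
      qed
      then have "card {..<r} \<le> card {..<r'}"
        by (meson surj_card_le finite_lessThan)
      then show ?thesis by simp
    qed
    ultimately show ?thesis by simp
  qed
qed

theorem theorem5p1:
  fixes i :: nat
  shows "\<exists>\<S> :: (nat \<Rightarrow> nat) set set.
    finite \<S> \<and> card \<S> = i \<and>
    (\<forall>S\<in>\<S>. subsemigroup_of_maps S \<and> closed S \<and> S \<subseteq> finite_image_maps) \<and>
    pairwise incomparable \<S>"
proof -
  \<comment> \<open>One parameter rises while the other falls; the shift by 2 and
    \<open>k < i\<close> keep them at least 2 and 1.\<close>
  define S where "S k = tree_semigroup (k + 2) (i - k)" for k
  have eq: "k = l" if "k < i" "l < i" "S k \<preceq> S l" for k l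
    using tree_semigroup_le_imp[of "l + 2" "k + 2" "i - k" "i - l"] that unfolding S_def by linarith
  \<comment> \<open>Equal semigroups are comparable by reflexivity, so \<open>eq\<close> also gives
    distinctness.\<close>
  have "inj_on S {..<i}"
    by (rule inj_onI) (metis eq generated_preorder_refl lessThan_iff)
  then have "card (S ` {..<i}) = i" by (simp add: card_image)
  moreover have "pairwise incomparable (S ` {..<i})"
    unfolding pairwise_def incomparable_def using eq by blast
  moreover have "\<forall>T\<in>S ` {..<i}. subsemigroup_of_maps T \<and> closed T \<and> T \<subseteq> finite_image_maps"
    using subsemigroup_tree_semigroup closed_tree_semigroup tree_semigroup_finite_image
    by (simp add: S_def)
  ultimately show ?thesis by (intro exI[of _ "S ` {..<i}"]) simp
qed

end
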